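(* Let $A$ be a finite group, let $\mathcal{C}$ be a finite EI-category with a right action of $A$, and let $r\ge 1$. Let $\alpha_r(\mathcal{C},A)$ and $\widetilde{\alpha}_r(\mathcal{C},A)$ be the $r$th equivariant Euler class function and the $r$th reduced equivariant Euler class function on $A$, and let $|C_A|$ be the class function $x\mapsto |C_A(x)|$ on $A$ (the permutation character of the conjugation action of $A$ on itself). Then $$\langle \alpha_r(\mathcal{C},A),|C_A|\rangle_A=\chi_r(\mathcal{C},A),\qquad \langle \widetilde{\alpha}_r(\mathcal{C},A),|C_A|\rangle_A=\widetilde{\chi}_r(\mathcal{C},A).$$
   Context: An EI-category is a category in which every endomorphism is an isomorphism. For a finite category $\mathcal{D}$, a weighting is a function $k^\bullet$ on objects with $\sum_b|\mathcal{D}(a,b)|k^b=1$ for all $a$, a coweighting is a function $k_\bullet$ with $\sum_a k_a|\mathcal{D}(a,b)|=1$ for all $b$; if both exist, the Euler characteristic (Leinster) is $\chi(\mathcal{D})=\sum_a k^a=\sum_b k_b$, and $\widetilde{\chi}(\mathcal{D})=\chi(\mathcal{D})-1$. Finite EI-categories have Euler characteristics. For a subset (or tuple) $X$ of $A$, the $X$-centralized subcategory $C_{\mathcal{C}}(X)$ is the subcategory of $\mathcal{C}$ whose objects are the objects $c$ with $c^x=c$ for all $x\in X$ and whose morphisms are the morphisms $\varphi$ between such objects with $\varphi^x=\varphi$ for all $x\in X$. It is acted on by $C_A(X)$. For $r\ge0$ let $C_r(A)$ be the set of $r$-tuples of pairwise commuting elements of $A$ (with $C_0(A)=\{e\}$,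 the set consisting of the unit element). For any finite group $A$ acting on a finite EI-category $\mathcal{C}$ and any $r\ge 0$, $$\chi_r(\mathcal{C},A)=\frac1{|A|}\sum_{x\in C_r(A)}\chi(C_{\mathcal{C}}(x)),\qquad \widetilde{\chi}_r(\mathcal{C},A)=\frac1{|A|}\sum_{x\in C_r(A)}\widetilde{\chi}(C_{\mathcal{C}}(x)).$$ For $r\ge1$, $\alpha_r(\mathcal{C},A)$ is the class function on $A$ with $\alpha_r(\mathcal{C},A)(x)=\chi_{r-1}(C_{\mathcal{C}}(x),C_A(x))$, and $\widetilde{\alpha}_r(\mathcal{C},A)(x)=\widetilde{\chi}_{r-1}(C_{\mathcal{C}}(x),C_A(x))$. For class functions $\varphi,\psi$ on $A$, $\langle\varphi,\psi\rangle_A=|A|^{-1}\sum_{x\in A}\varphi(x)\overline{\psi(x)}$. *)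

theory Defs
  imports Complex_Main "HOL-Algebra.Coset"
begin

section \<open>Finite EI-categories\<close>

record ('o, 'm) cat =
  Obj :: "'o set"
  Mor :: "'m set"
  Dom :: "'m \<Rightarrow> 'o"
  Cod :: "'m \<Rightarrow> 'o"
  Ide :: "'o \<Rightarrow> 'm"
  Cmp :: "'m \<Rightarrow> 'm \<Rightarrow> 'm"

definition Homs :: "('o, 'm) cat \<Rightarrow> 'o \<Rightarrow> 'o \<Rightarrow> 'm set" where
  "Homs C a b = {f \<in> Mor C. Dom C f = a \<and> Cod C f = b}"

text \<open>\<open>Cmp C g f\<close> is the composite of \<open>g\<close> after \<open>f\<close>.\<close>

locale category =
  fixes C :: "('o, 'm) cat"
  assumes Dom_in: "f \<in> Mor C \<Longrightarrow> Dom C f \<in> Obj C"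
    and Cod_in: "f \<in> Mor C \<Longrightarrow> Cod C f \<in> Obj C"
    and Ide_in: "a \<in> Obj C \<Longrightarrow> Ide C a \<in> Homs C a a"
    and Cmp_in: "\<lbrakk>f \<in> Homs C a b; g \<in> Homs C b c\<rbrakk> \<Longrightarrow> Cmp C g f \<in> Homs C a c"
    and Cmp_Ide: "f \<in> Homs C a b \<Longrightarrow> Cmp C f (Ide C a) = f"
    and Ide_Cmp: "f \<in> Homs C a b \<Longrightarrow> Cmp C (Ide C b) f = f"
    and Cmp_assoc: "\<lbrakk>f \<in> Homs C a b; g \<in> Homs C b c; h \<in> Homs C c d\<rbrakk>
      \<Longrightarrow> Cmp C h (Cmp C g f) = Cmp C (Cmp C h g) f"

definition isomorphism :: "('o, 'm) cat \<Rightarrow> 'm \<Rightarrow> bool" where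
  "isomorphism C f \<longleftrightarrow> f \<in> Mor C \<and>
    (\<exists>g \<in> Homs C (Cod C f) (Dom C f).
      Cmp C g f = Ide C (Dom C f) \<and> Cmp C f g = Ide C (Cod C f))"

locale finite_EI_category = category +
  assumes finite_Obj: "finite (Obj C)"
    and finite_Mor: "finite (Mor C)"
    and EI: "\<lbrakk>a \<in> Obj C; f \<in> Homs C a a\<rbrakk> \<Longrightarrow> isomorphism C f"


section \<open>Leinster's Euler characteristic\<close>

definition weighting :: "('o, 'm) cat \<Rightarrow> ('o \<Rightarrow> rat) \<Rightarrow> bool" where
  "weighting D k \<longleftrightarrow>
    (\<forall>a \<in> Obj D. (\<Sum>b \<in> Obj D. of_nat (card (Homs D a b)) * k b) = 1)"

definition coweighting :: "('o, 'm) cat \<Rightarrow> ('o \<Rightarrow> rat) \<Rightarrow> bool" where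
  "coweighting D k \<longleftrightarrow>
    (\<forall>b \<in> Obj D. (\<Sum>a \<in> Obj D. k a * of_nat (card (Homs D a b))) = 1)"

definition euler_char :: "('o, 'm) cat \<Rightarrow> rat" where
  "euler_char D = (THE q. \<exists>k l. weighting D k \<and> coweighting D l \<and>
     q = (\<Sum>a \<in> Obj D. k a) \<and> q = (\<Sum>b \<in> Obj D. l b))"

definition reduced_euler_char :: "('o, 'm) cat \<Rightarrow> rat" where
  "reduced_euler_char D = euler_char D - 1"

lemma weighting_sum_eq_coweighting_sum:
  assumes k: "weighting D k" and l: "coweighting D l"
  shows "(\<Sum>a \<in> Obj D. k a) = (\<Sum>b \<in> Obj D. l b)"
proof -
  let ?n = "\<lambda>a b. of_nat (card (Homs D a b)) :: rat"
  have "(\<Sum>b \<in> Obj D. k b) = (\<Sum>b \<in> Obj D. (\<Sum>a \<in> Obj D. l a * ?n a b) * k b)"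
    using l by (intro sum.cong) (auto simp: coweighting_def)
  also have "\<dots> = (\<Sum>b \<in> Obj D. \<Sum>a \<in> Obj D. l a * ?n a b * k b)"
    by (simp add: sum_distrib_right)
  also have "\<dots> = (\<Sum>a \<in> Obj D. \<Sum>b \<in> Obj D. l a * ?n a b * k b)"
    by (rule sum.swap)
  also have "\<dots> = (\<Sum>a \<in> Obj D. l a * (\<Sum>b \<in> Obj D. ?n a b * k b))"
    by (simp add: sum_distrib_left mult.assoc)
  also have "\<dots> = (\<Sum>a \<in> Obj D. l a)"
    using k by (intro sum.cong) (auto simp: weighting_def)
  finally show ?thesis .
qed

lemma euler_char_eq:
  assumes k: "weighting D k" and l: "coweighting D l"
  shows "euler_char D = (\<Sum>a \<in> Obj D. k a)" and "euler_char D = (\<Sum>b \<in> Obj D. l b)"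
proof -
  show *: "euler_char D = (\<Sum>a \<in> Obj D. k a)"
    unfolding euler_char_def
  proof (rule the_equality)
    show "\<exists>k' l'. weighting D k' \<and> coweighting D l' \<and>
       (\<Sum>a \<in> Obj D. k a) = (\<Sum>a \<in> Obj D. k' a) \<and> (\<Sum>a \<in> Obj D. k a) = (\<Sum>b \<in> Obj D. l' b)"
      using k l weighting_sum_eq_coweighting_sum[OF k l] by blast
  next
    fix q assume "\<exists>k' l'. weighting D k' \<and> coweighting D l' \<and>
       q = (\<Sum>a \<in> Obj D. k' a) \<and> q = (\<Sum>b \<in> Obj D. l' b)"
    then show "q = (\<Sum>a \<in> Obj D. k a)"
      using weighting_sum_eq_coweighting_sum[OF k] by metis
  qed
  show "euler_char D = (\<Sum>b \<in> Obj D. l b)"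
    using * weighting_sum_eq_coweighting_sum[OF k l] by simp
qed


section \<open>Right actions and centralized subcategories\<close>

text \<open>A right action consists of functions \<open>oact c g\<close>, written $c^g$ on paper, on objects and
  \<open>mact f g\<close> on morphisms.\<close>

locale category_action = category C + group A
  for C :: "('o, 'm) cat" and A :: "'a monoid" (structure)
    and oact :: "'o \<Rightarrow> 'a \<Rightarrow> 'o" and mact :: "'m \<Rightarrow> 'a \<Rightarrow> 'm" +
  assumes oact_in: "\<lbrakk>g \<in> carrier A; c \<in> Obj C\<rbrakk> \<Longrightarrow> oact c g \<in> Obj C"
    and mact_in: "\<lbrakk>g \<in> carrier A; f \<in> Homs C a b\<rbrakk> \<Longrightarrow> mact f g \<in> Homs C (oact a g) (oact b g)"
    and mact_Ide: "\<lbrakk>g \<in> carrier A; c \<in> Obj C\<rbrakk> \<Longrightarrow> mact (Ide C c) g = Ide C (oact c g)"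
    and mact_Cmp: "\<lbrakk>g \<in> carrier A; f \<in> Homs C a b; f' \<in> Homs C b c\<rbrakk>
      \<Longrightarrow> mact (Cmp C f' f) g = Cmp C (mact f' g) (mact f g)"
    and oact_one: "c \<in> Obj C \<Longrightarrow> oact c \<one> = c"
    and mact_one: "f \<in> Mor C \<Longrightarrow> mact f \<one> = f"
    and oact_mult: "\<lbrakk>g \<in> carrier A; h \<in> carrier A; c \<in> Obj C\<rbrakk>
      \<Longrightarrow> oact c (g \<otimes> h) = oact (oact c g) h"
    and mact_mult: "\<lbrakk>g \<in> carrier A; h \<in> carrier A; f \<in> Mor C\<rbrakk>
      \<Longrightarrow> mact f (g \<otimes> h) = mact (mact f g) h"

definition centralizer :: "'a monoid \<Rightarrow> 'a set \<Rightarrow> 'a monoid" where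
  "centralizer A X = A\<lparr>carrier := {g \<in> carrier A. \<forall>x\<in>X. g \<otimes>\<^bsub>A\<^esub> x = x \<otimes>\<^bsub>A\<^esub> g}\<rparr>"

definition centralized_subcat ::
    "('o, 'm) cat \<Rightarrow> ('o \<Rightarrow> 'a \<Rightarrow> 'o) \<Rightarrow> ('m \<Rightarrow> 'a \<Rightarrow> 'm) \<Rightarrow> 'a set \<Rightarrow> ('o, 'm) cat" where
  "centralized_subcat C oact mact X =
    (let Ob = {c \<in> Obj C. \<forall>x\<in>X. oact c x = c}
     in C\<lparr>Obj := Ob,
          Mor := {f \<in> Mor C. Dom C f \<in> Ob \<and> Cod C f \<in> Ob \<and> (\<forall>x\<in>X. mact f x = f)}\<rparr>)"


section \<open>Equivariant Euler characteristics and Euler class functions\<close>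

text \<open>Tuples are lists. By convention \<open>C\<^sub>0(A)\<close> consists of the unit element only, here in the
  form of the one-element list \<open>[\<one>]\<close>.\<close>

definition commuting_tuples :: "nat \<Rightarrow> 'a monoid \<Rightarrow> 'a list set" where
  "commuting_tuples r A =
    (if r = 0 then {[\<one>\<^bsub>A\<^esub>]}
     else {xs. length xs = r \<and> set xs \<subseteq> carrier A \<and>
               (\<forall>x\<in>set xs. \<forall>y\<in>set xs. x \<otimes>\<^bsub>A\<^esub> y = y \<otimes>\<^bsub>A\<^esub> x)})"

definition equivariant_euler_char ::
    "nat \<Rightarrow> ('o, 'm) cat \<Rightarrow> 'a monoid \<Rightarrow> ('o \<Rightarrow> 'a \<Rightarrow> 'o) \<Rightarrow> ('m \<Rightarrow> 'a \<Rightarrow> 'm) \<Rightarrow> rat" where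
  "equivariant_euler_char r C A oact mact =
    1 / of_nat (order A) *
      (\<Sum>xs \<in> commuting_tuples r A. euler_char (centralized_subcat C oact mact (set xs)))"

definition reduced_equivariant_euler_char ::
    "nat \<Rightarrow> ('o, 'm) cat \<Rightarrow> 'a monoid \<Rightarrow> ('o \<Rightarrow> 'a \<Rightarrow> 'o) \<Rightarrow> ('m \<Rightarrow> 'a \<Rightarrow> 'm) \<Rightarrow> rat" where
  "reduced_equivariant_euler_char r C A oact mact =
    1 / of_nat (order A) *
      (\<Sum>xs \<in> commuting_tuples r A. reduced_euler_char (centralized_subcat C oact mact (set xs)))"

text \<open>The class functions below are meant for \<open>r \<ge> 1\<close> only.\<close>

definition euler_class_fun ::
    "nat \<Rightarrow> ('o, 'm) cat \<Rightarrow> 'a monoid \<Rightarrow> ('o \<Rightarrow> 'a \<Rightarrow> 'o) \<Rightarrow> ('m \<Rightarrow> 'a \<Rightarrow> 'm) \<Rightarrow> 'a \<Rightarrow> complex" where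
  "euler_class_fun r C A oact mact x =
    of_rat (equivariant_euler_char (r - 1)
      (centralized_subcat C oact mact {x}) (centralizer A {x}) oact mact)"

definition reduced_euler_class_fun ::
    "nat \<Rightarrow> ('o, 'm) cat \<Rightarrow> 'a monoid \<Rightarrow> ('o \<Rightarrow> 'a \<Rightarrow> 'o) \<Rightarrow> ('m \<Rightarrow> 'a \<Rightarrow> 'm) \<Rightarrow> 'a \<Rightarrow> complex" where
  "reduced_euler_class_fun r C A oact mact x =
    of_rat (reduced_equivariant_euler_char (r - 1)
      (centralized_subcat C oact mact {x}) (centralizer A {x}) oact mact)"

definition class_inner :: "'a monoid \<Rightarrow> ('a \<Rightarrow> complex) \<Rightarrow> ('a \<Rightarrow> complex) \<Rightarrow> complex" where
  "class_inner A \<phi> \<psi> = 1 / of_nat (order A) * (\<Sum>x \<in> carrier A. \<phi> x * cnj (\<psi> x))"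

definition centralizer_order :: "'a monoid \<Rightarrow> 'a \<Rightarrow> complex" where
  "centralizer_order A x = of_nat (order (centralizer A {x}))"


section \<open>Centralized subcategories are again finite EI-categories with an action\<close>

lemma Homs_centralized_subcat:
  "f \<in> Homs (centralized_subcat C oact mact X) a b \<longleftrightarrow>
    f \<in> Homs C a b \<and> a \<in> Obj C \<and> b \<in> Obj C \<and>
    (\<forall>x\<in>X. oact a x = a \<and> oact b x = b \<and> mact f x = f)"
  by (auto simp: Homs_def centralized_subcat_def Let_def)

lemma Obj_centralized_subcat:
  "c \<in> Obj (centralized_subcat C oact mact X) \<longleftrightarrow> c \<in> Obj C \<and> (\<forall>x\<in>X. oact c x = c)"
  by (auto simp: centralized_subcat_def Let_def)

lemma Mor_centralized_subcat:
  "f \<in> Mor (centralized_subcat C oact mact X) \<longleftrightarrow>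
     f \<in> Mor C \<and> Dom C f \<in> Obj C \<and> Cod C f \<in> Obj C \<and>
     (\<forall>x\<in>X. oact (Dom C f) x = Dom C f \<and> oact (Cod C f) x = Cod C f \<and> mact f x = f)"
  by (auto simp: centralized_subcat_def Let_def)

lemma centralized_subcat_sel [simp]:
  "Dom (centralized_subcat C oact mact X) = Dom C"
  "Cod (centralized_subcat C oact mact X) = Cod C"
  "Ide (centralized_subcat C oact mact X) = Ide C"
  "Cmp (centralized_subcat C oact mact X) = Cmp C"
  by (auto simp: centralized_subcat_def Let_def)

context category_action
begin

lemma category_centralized_subcat:
  assumes X: "X \<subseteq> carrier A"
  shows "category (centralized_subcat C oact mact X)"
proof
  fix f g a b c
  assume f: "f \<in> Homs (centralized_subcat C oact mact X) a b"
    and g: "g \<in> Homs (centralized_subcat C oact mact X) b c"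
  have "mact (Cmp C g f) x = Cmp C g f" if "x \<in> X" for x
    using mact_Cmp[of x f a b g c] f g that X by (auto simp: Homs_centralized_subcat)
  then show "Cmp (centralized_subcat C oact mact X) g f
      \<in> Homs (centralized_subcat C oact mact X) a c"
    using f g by (auto simp: Homs_centralized_subcat intro: Cmp_in)
next
  fix f g h a b c d
  assume "f \<in> Homs (centralized_subcat C oact mact X) a b"
    and "g \<in> Homs (centralized_subcat C oact mact X) b c"
    and "h \<in> Homs (centralized_subcat C oact mact X) c d"
  then show "Cmp (centralized_subcat C oact mact X) h (Cmp (centralized_subcat C oact mact X) g f)
      = Cmp (centralized_subcat C oact mact X) (Cmp (centralized_subcat C oact mact X) h g) f"
    using Cmp_assoc[of f a b g c h d] by (auto simp: Homs_centralized_subcat)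
next
  fix a assume "a \<in> Obj (centralized_subcat C oact mact X)"
  then show "Ide (centralized_subcat C oact mact X) a
      \<in> Homs (centralized_subcat C oact mact X) a a"
    using X mact_Ide[of _ a]
    by (auto simp: Homs_centralized_subcat Obj_centralized_subcat intro: Ide_in)
qed (auto simp: Homs_centralized_subcat Obj_centralized_subcat Mor_centralized_subcat
       Cmp_Ide Ide_Cmp)

lemma finite_EI_centralized_subcat:
  assumes X: "X \<subseteq> carrier A" and fin: "finite_EI_category C"
  shows "finite_EI_category (centralized_subcat C oact mact X)"
proof -
  let ?D = "centralized_subcat C oact mact X"
  interpret F: finite_EI_category C by (rule fin)
  interpret D: category ?D by (rule category_centralized_subcat[OF X])
  show ?thesis
  proof
    show "finite (Obj ?D)" using F.finite_Obj
      by (rule rev_finite_subset) (auto simp: Obj_centralized_subcat)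
    show "finite (Mor ?D)" using F.finite_Mor
      by (rule rev_finite_subset) (auto simp: Mor_centralized_subcat)
    fix a f assume a: "a \<in> Obj ?D" and f: "f \<in> Homs ?D a a"
    have aC: "a \<in> Obj C" and fC: "f \<in> Homs C a a"
      using a f by (auto simp: Obj_centralized_subcat Homs_centralized_subcat)
    obtain g where g: "g \<in> Homs C a a" and gf: "Cmp C g f = Ide C a" and fg: "Cmp C f g = Ide C a"
      using F.EI[OF aC fC] fC by (auto simp: isomorphism_def Homs_def)
    have "mact g x = g" if x: "x \<in> X" for x
    proof -
      have xA: "x \<in> carrier A" and ax: "oact a x = a" and fx: "mact f x = f"
        using x X a f by (auto simp: Obj_centralized_subcat Homs_centralized_subcat)
      have gx: "mact g x \<in> Homs C a a" using mact_in[OF xA g] ax by simp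
      have "Cmp C (mact g x) f = Ide C a"
        using mact_Cmp[OF xA fC g] mact_Ide[OF xA aC] gf ax fx by simp
      then have "Cmp C (Cmp C (mact g x) f) g = g"
        using Ide_Cmp[OF g] by simp
      then show ?thesis
        using Cmp_assoc[OF g fC gx] fg Cmp_Ide[OF gx] by simp
    qed
    then have "g \<in> Homs ?D a a"
      using g a by (auto simp: Obj_centralized_subcat Homs_centralized_subcat)
    then show "isomorphism ?D f"
      using f gf fg by (auto simp: isomorphism_def Homs_def)
  qed
qed

lemma group_centralizer:
  assumes X: "X \<subseteq> carrier A"
  shows "group (centralizer A X)"
proof -
  have "subgroup {g \<in> carrier A. \<forall>x\<in>X. g \<otimes> x = x \<otimes> g} A"
  proof (rule subgroupI)
    fix a assume a: "a \<in> {g \<in> carrier A. \<forall>x\<in>X. g \<otimes> x = x \<otimes> g}"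
    have "inv a \<otimes> x = x \<otimes> inv a" if "x \<in> X" for x
    proof -
      have c: "a \<in> carrier A" "x \<in> carrier A" "a \<otimes> x = x \<otimes> a" using a that X by auto
      have "inv a \<otimes> x = inv a \<otimes> (x \<otimes> a) \<otimes> inv a"
        using c(1,2) by (simp add: m_assoc)
      also have "\<dots> = inv a \<otimes> (a \<otimes> x) \<otimes> inv a" using c(3) by simp
      also have "\<dots> = x \<otimes> inv a" using c(1,2) by (simp flip: m_assoc)
      finally show ?thesis .
    qed
    then show "inv a \<in> {g \<in> carrier A. \<forall>x\<in>X. g \<otimes> x = x \<otimes> g}" using a by auto
  next
    fix a b assume ab: "a \<in> {g \<in> carrier A. \<forall>x\<in>X. g \<otimes> x = x \<otimes> g}"
      "b \<in> {g \<in> carrier A. \<forall>x\<in>X. g \<otimes> x = x \<otimes> g}"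
    have "a \<otimes> b \<otimes> x = x \<otimes> (a \<otimes> b)" if "x \<in> X" for x
    proof -
      have "a \<in> carrier A" "b \<in> carrier A" "x \<in> carrier A" "a \<otimes> x = x \<otimes> a" "b \<otimes> x = x \<otimes> b"
        using ab that X by auto
      then show ?thesis by (metis m_assoc)
    qed
    then show "a \<otimes> b \<in> {g \<in> carrier A. \<forall>x\<in>X. g \<otimes> x = x \<otimes> g}" using ab by auto
  next
    show "{g \<in> carrier A. \<forall>x\<in>X. g \<otimes> x = x \<otimes> g} \<noteq> {}"
      using X by (auto intro!: exI[of _ \<one>])
  qed auto
  then show ?thesis unfolding centralizer_def by (rule subgroup_imp_group)
qed

lemma category_action_centralized_subcat:
  assumes X: "X \<subseteq> carrier A"
  shows "category_action (centralized_subcat C oact mact X) (centralizer A X) oact mact"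
proof -
  let ?D = "centralized_subcat C oact mact X" and ?B = "centralizer A X"
  interpret D: category ?D by (rule category_centralized_subcat[OF X])
  interpret B: group ?B by (rule group_centralizer[OF X])
  have B: "g \<in> carrier A" "\<And>x. x \<in> X \<Longrightarrow> g \<otimes> x = x \<otimes> g" if "g \<in> carrier ?B" for g
    using that by (auto simp: centralizer_def)
  have o: "oact (oact c g) x = oact c g"
    if "g \<in> carrier ?B" "c \<in> Obj C" "oact c x = c" "x \<in> X" for c g x
    using that X B[of g] oact_mult[of g x c] oact_mult[of x g c] by auto
  have m: "mact (mact f g) x = mact f g"
    if "g \<in> carrier ?B" "f \<in> Mor C" "mact f x = f" "x \<in> X" for f g x
    using that X B[of g] mact_mult[of g x f] mact_mult[of x g f] by auto
  have Homs_Mor: "f \<in> Homs C a b \<Longrightarrow> f \<in> Mor C" for f a b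
    by (simp add: Homs_def)
  show ?thesis
  proof
    fix g f a b assume "g \<in> carrier ?B" "f \<in> Homs ?D a b"
    then show "mact f g \<in> Homs ?D (oact a g) (oact b g)"
      using B[of g] o[of g] m[of g] Homs_Mor[of f a b]
      by (auto simp: Homs_centralized_subcat intro: mact_in oact_in)
  next
    fix g f f' a b c assume "g \<in> carrier ?B" "f \<in> Homs ?D a b" "f' \<in> Homs ?D b c"
    then show "mact (Cmp ?D f' f) g = Cmp ?D (mact f' g) (mact f g)"
      using B[of g] mact_Cmp[of g f a b f' c] by (auto simp: Homs_centralized_subcat)
  qed (use o m in \<open>auto simp: Obj_centralized_subcat Mor_centralized_subcat centralizer_def
        oact_in mact_Ide oact_one mact_one oact_mult mact_mult\<close>)
qed

end

end

theory Submission
  imports Defs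
begin

text \<open>
  Multiplying the value of the class function at \<open>x\<close> by \<open>|C\<^sub>A(x)|\<close> cancels the
  normalizing factor of the equivariant Euler characteristic of the centralizer, so up to the
  factor \<open>1/|A|\<close> the inner product is a sum over pairs of an element \<open>x\<close> of \<open>A\<close> and a
  commuting \<open>(r - 1)\<close>-tuple \<open>ys\<close> in \<open>C\<^sub>A(x)\<close>. Such pairs are exactly the commuting \<open>r\<close>-tuples
  \<open>x # ys\<close> of \<open>A\<close> (\<open>sum_commuting_tuples_Suc\<close>), and centralizing first by \<open>x\<close> and then by \<open>ys\<close>
  is centralizing by the whole tuple (\<open>centralized_subcat_centralized_subcat\<close>). Hence both sides
  are the same sum of (reduced) Euler characteristics.

  Only the value \<open>F X\<close> attached to the underlying set \<open>X\<close> of a tuple enters this argument. It is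
  therefore carried out for an arbitrary rational function \<open>F\<close> of subsets of \<open>A\<close>
  (\<open>class_inner_centralizer_order\<close>), subject to one condition: since the only \<open>0\<close>-tuple is
  encoded as the list \<open>[\<one>]\<close>, adjoining the unit to a singleton must not change \<open>F\<close>. For
  centralized subcategories this holds because the unit acts trivially.
\<close>

lemma centralized_subcat_centralized_subcat:
  "centralized_subcat (centralized_subcat C oact mact X) oact mact Y =
    centralized_subcat C oact mact (X \<union> Y)"
  by (auto simp: centralized_subcat_def Let_def
      intro!: arg_cong2[where f = "\<lambda>a b. C\<lparr>Obj := a, Mor := b\<rparr>"])

lemma (in category_action) centralized_subcat_insert_one:
  "centralized_subcat C oact mact (insert \<one> X) = centralized_subcat C oact mact X"
proof -
  have "{c \<in> Obj C. \<forall>x\<in>insert \<one> X. oact c x = c} = {c \<in> Obj C. \<forall>x\<in>X. oact c x = c}"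
    by (auto simp: oact_one)
  then show ?thesis
    unfolding centralized_subcat_def Let_def
    by (auto simp: mact_one intro!: arg_cong[where f = "\<lambda>b. C\<lparr>Obj := _, Mor := b\<rparr>"])
qed

lemma finite_commuting_tuples:
  assumes "finite (carrier A)"
  shows "finite (commuting_tuples r A)"
proof (cases "r = 0")
  case False
  then have "commuting_tuples r A \<subseteq> {xs. set xs \<subseteq> carrier A \<and> length xs = r}"
    by (auto simp: commuting_tuples_def)
  then show ?thesis
    using finite_lists_length_eq[OF assms] by (rule finite_subset)
qed (simp add: commuting_tuples_def)

lemma Cons_in_commuting_tuples_iff:
  assumes "r > 0"
  shows "x # ys \<in> commuting_tuples (Suc r) A \<longleftrightarrow>
    x \<in> carrier A \<and> ys \<in> commuting_tuples r (centralizer A {x})"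
  using assms by (auto simp: commuting_tuples_def centralizer_def)

lemma sum_commuting_tuples_Suc:
  fixes A :: "'a monoid" (structure) and F :: "'a set \<Rightarrow> rat"
  assumes fin: "finite (carrier A)"
    and F_one: "\<And>x. x \<in> carrier A \<Longrightarrow> F {x, \<one>} = F {x}"
  shows "(\<Sum>x\<in>carrier A. \<Sum>ys\<in>commuting_tuples r (centralizer A {x}). F (insert x (set ys))) =
    (\<Sum>xs\<in>commuting_tuples (Suc r) A. F (set xs))"
proof (cases "r = 0")
  case True
  \<comment> \<open>The inner sum has the single index \<open>[\<one>]\<close> and not \<open>[]\<close>, so the pairs are \<open>x, [\<one>]\<close>, while
    the tuples on the right are \<open>[x]\<close>.\<close>
  have "commuting_tuples (Suc 0) A = (\<lambda>x. [x]) ` carrier A"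
    by (auto simp: commuting_tuples_def length_Suc_conv)
  then have "(\<Sum>xs\<in>commuting_tuples (Suc 0) A. F (set xs)) = (\<Sum>x\<in>carrier A. F {x})"
    by (simp add: sum.reindex inj_on_def)
  then show ?thesis
    using True by (simp add: commuting_tuples_def centralizer_def F_one)
next
  case False
  let ?S = "SIGMA x:carrier A. commuting_tuples r (centralizer A {x})"
  have "bij_betw (\<lambda>(x, ys). x # ys) ?S (commuting_tuples (Suc r) A)"
  proof (rule bij_betw_imageI)
    show "inj_on (\<lambda>(x, ys). x # ys) ?S"
      by (auto simp: inj_on_def)
    have "xs \<in> (\<lambda>(x, ys). x # ys) ` ?S" if "xs \<in> commuting_tuples (Suc r) A" for xs
    proof (cases xs)
      case Nil
      with that show ?thesis by (simp add: commuting_tuples_def)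
    next
      case (Cons x ys)
      with that False show ?thesis by (auto simp: Cons_in_commuting_tuples_iff)
    qed
    with False show "(\<lambda>(x, ys). x # ys) ` ?S = commuting_tuples (Suc r) A"
      by (auto simp: Cons_in_commuting_tuples_iff)
  qed
  from sum.reindex_bij_betw[OF this, of "\<lambda>xs. F (set xs)"]
  have "(\<Sum>(x, ys)\<in>?S. F (insert x (set ys))) =
      (\<Sum>xs\<in>commuting_tuples (Suc r) A. F (set xs))"
    by (simp add: case_prod_unfold)
  moreover have "finite (commuting_tuples r (centralizer A {x}))" for x
    using fin by (intro finite_commuting_tuples) (simp add: centralizer_def)
  ultimately show ?thesis
    using fin by (simp add: sum.Sigma)
qed

lemma class_inner_centralizer_order:
  fixes A :: "'a monoid" (structure) and F :: "'a set \<Rightarrow> rat"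
  assumes "group A" and fin: "finite (carrier A)" and r: "r \<ge> 1"
    and F_one: "\<And>x. x \<in> carrier A \<Longrightarrow> F {x, \<one>} = F {x}"
    and \<alpha>: "\<And>x. x \<in> carrier A \<Longrightarrow> \<alpha> x = of_rat (1 / of_nat (order (centralizer A {x})) *
      (\<Sum>ys\<in>commuting_tuples (r - 1) (centralizer A {x}). F (insert x (set ys))))"
  shows "class_inner A \<alpha> (centralizer_order A) =
    of_rat (1 / of_nat (order A) * (\<Sum>xs\<in>commuting_tuples r A. F (set xs)))"
proof -
  interpret group A by fact
  have "\<alpha> x * cnj (centralizer_order A x) =
      of_rat (\<Sum>ys\<in>commuting_tuples (r - 1) (centralizer A {x}). F (insert x (set ys)))"
    if x: "x \<in> carrier A" for x
  proof -
    have "\<one> \<in> carrier (centralizer A {x})" "finite (carrier (centralizer A {x}))"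
      using x fin by (auto simp: centralizer_def)
    then have "order (centralizer A {x}) \<noteq> 0"
      by (auto simp: order_def)
    then show ?thesis
      by (simp add: \<alpha>[OF x] centralizer_order_def of_rat_mult of_rat_divide)
  qed
  then have "class_inner A \<alpha> (centralizer_order A) = of_rat (1 / of_nat (order A) *
      (\<Sum>x\<in>carrier A. \<Sum>ys\<in>commuting_tuples (r - 1) (centralizer A {x}). F (insert x (set ys))))"
    by (simp add: class_inner_def of_rat_mult of_rat_divide of_rat_sum)
  then show ?thesis
    using sum_commuting_tuples_Suc[OF fin F_one, of "r - 1"] r by simp
qed

theorem mainTheorem2:
  fixes A :: "'a monoid" and C :: "('o, 'm) cat"
    and oact :: "'o \<Rightarrow> 'a \<Rightarrow> 'o" and mact :: "'m \<Rightarrow> 'a \<Rightarrow> 'm" and r :: nat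
  assumes "group A" and "finite (carrier A)"
    and "finite_EI_category C"
    and "category_action C A oact mact"
    and "r \<ge> 1"
  shows "class_inner A (euler_class_fun r C A oact mact) (centralizer_order A)
           = of_rat (equivariant_euler_char r C A oact mact)
       \<and> class_inner A (reduced_euler_class_fun r C A oact mact) (centralizer_order A)
           = of_rat (reduced_equivariant_euler_char r C A oact mact)"
proof -
  interpret category_action C A oact mact by fact
  let ?D = "centralized_subcat C oact mact"
  have one: "?D {x, \<one>\<^bsub>A\<^esub>} = ?D {x}" for x
    using centralized_subcat_insert_one[of "{x}"] by (simp add: insert_commute)
  have "class_inner A (euler_class_fun r C A oact mact) (centralizer_order A) =
      of_rat (1 / of_nat (order A) * (\<Sum>xs\<in>commuting_tuples r A. euler_char (?D (set xs))))"
    by (rule class_inner_centralizer_order)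
      (use assms in \<open>simp_all add: one euler_class_fun_def equivariant_euler_char_def
        centralized_subcat_centralized_subcat\<close>)
  moreover have "class_inner A (reduced_euler_class_fun r C A oact mact) (centralizer_order A) =
      of_rat (1 / of_nat (order A) *
        (\<Sum>xs\<in>commuting_tuples r A. reduced_euler_char (?D (set xs))))"
    by (rule class_inner_centralizer_order)
      (use assms in \<open>simp_all add: one reduced_euler_class_fun_def
        reduced_equivariant_euler_char_def centralized_subcat_centralized_subcat\<close>)
  ultimately show ?thesis
    by (simp add: equivariant_euler_char_def reduced_equivariant_euler_char_def)
qed

end
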